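(* Let $a$ be an integer with $a\notin\{0,1,-1\}$, and let $\{u_n\}_{n\geq0}$ be defined by $u_0=0$, $u_1=1$, $u_{n+1}=(2-a)u_n-(a^2-a+1)u_{n-1}$ for $n\geq1$. Then for all $n\geq1$, $$\Delta_3(0,n)=(2-a)u_n-2(a^2-a+1)u_{n-1}=2u_{n+1}-(2-a)u_n,$$ $$\Delta_3(1,n)=(2a-1)u_n+(a^2-a+1)u_{n-1}=-u_{n+1}+(a+1)u_n,$$ $$\Delta_3(2,n)=(-a-1)u_n+(a^2-a+1)u_{n-1}=-u_{n+1}-(2a-1)u_n.$$
   Context: For integers $n>0$ and $r$, $\Delta_3(r,n)=3\sum_{0\le k\le n,\ k\equiv r\ (\mathrm{mod}\ 3)}\binom nk a^k-(1+a)^n$. *)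

theory Defs
  imports "HOL-Number_Theory.Cong"
begin

definition Delta3 :: "int \<Rightarrow> int \<Rightarrow> nat \<Rightarrow> int" where
  "Delta3 a r n =
     3 * (\<Sum>k \<in> {k. 0 \<le> k \<and> k \<le> n \<and> [int k = r] (mod 3)}. int (n choose k) * a ^ k) - (1 + a) ^ n"

end

theory Submission
  imports Defs
begin

text \<open>Pascal's rule gives \<open>\<Delta>\<^sub>3(r, n + 1) = \<Delta>\<^sub>3(r, n) + a \<Delta>\<^sub>3(r - 1, n)\<close>. The expressions
  in terms of \<open>u\<^sub>n\<close> and \<open>u\<^sub>n\<^sub>+\<^sub>1\<close> satisfy the same system and agree with \<open>\<Delta>\<^sub>3\<close> already at
  \<open>n = 0\<close>, where the three values are \<open>2, -1, -1\<close>.\<close>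

text \<open>Pascal's rule summed against an arbitrary weight \<open>f\<close>; leaving
  \<open>f\<close> general lets a residue condition be absorbed into it.\<close>

lemma sum_choose_Suc_mult:
  fixes f :: "nat \<Rightarrow> 'a::comm_semiring_1"
  shows "(\<Sum>k\<le>Suc n. of_nat (Suc n choose k) * f k) = (\<Sum>k\<le>n. of_nat (n choose k) * (f k + f (Suc k)))"
proof -
  have "(\<Sum>k\<le>Suc n. of_nat (Suc n choose k) * f k)
      = f 0 + (\<Sum>k\<le>n. of_nat (n choose Suc k) * f (Suc k)) + (\<Sum>k\<le>n. of_nat (n choose k) * f (Suc k))"
    by (subst sum.atMost_Suc_shift) (simp add: algebra_simps sum.distrib)
  \<comment> \<open>\<open>f 0\<close> supplies the missing \<open>k = 0\<close> term; the top term
    \<open>n choose Suc n\<close> is zero and is dropped next.\<close>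
  also have "f 0 + (\<Sum>k\<le>n. of_nat (n choose Suc k) * f (Suc k)) = (\<Sum>k\<le>Suc n. of_nat (n choose k) * f k)"
    by (subst sum.atMost_Suc_shift) simp
  also have "\<dots> = (\<Sum>k\<le>n. of_nat (n choose k) * f k)"
    by (simp add: binomial_eq_0)
  finally show ?thesis
    by (simp add: distrib_left sum.distrib)
qed

text \<open>Moving the congruence from the index set into the weight gives the form that
  \<open>sum_choose_Suc_mult\<close> needs.\<close>

lemma Delta3_eq_sum_atMost:
  "Delta3 a r n = 3 * (\<Sum>k\<le>n. int (n choose k) * (if [int k = r] (mod 3) then a ^ k else 0)) - (1 + a) ^ n"
proof -
  have "{k. 0 \<le> k \<and> k \<le> n \<and> [int k = r] (mod 3)} = {k \<in> {..n}. [int k = r] (mod 3)}"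
    by auto
  then have "(\<Sum>k \<in> {k. 0 \<le> k \<and> k \<le> n \<and> [int k = r] (mod 3)}. int (n choose k) * a ^ k)
      = (\<Sum>k\<le>n. if [int k = r] (mod 3) then int (n choose k) * a ^ k else 0)"
    by (simp only: sum.inter_filter finite_atMost)
  also have "\<dots> = (\<Sum>k\<le>n. int (n choose k) * (if [int k = r] (mod 3) then a ^ k else 0))"
    by (intro sum.cong) auto
  finally show ?thesis
    by (simp add: Delta3_def)
qed

text \<open>The weight at \<open>Suc k\<close> for residue \<open>r\<close> is \<open>a\<close>
  times the weight at \<open>k\<close> for residue \<open>r - 1\<close>, and
  \<open>(1 + a) ^ Suc n\<close> splits in the same proportion.\<close>

lemma Delta3_Suc: "Delta3 a r (Suc n) = Delta3 a r n + a * Delta3 a (r - 1) n"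
proof -
  have shift: "[int (Suc k) = r] (mod 3) \<longleftrightarrow> [int k = r - 1] (mod 3)" for k
    by (simp add: cong_iff_dvd_diff algebra_simps)
  have "(\<Sum>k\<le>Suc n. int (Suc n choose k) * (if [int k = r] (mod 3) then a ^ k else 0))
      = (\<Sum>k\<le>n. int (n choose k) * ((if [int k = r] (mod 3) then a ^ k else 0)
          + (if [int (Suc k) = r] (mod 3) then a ^ Suc k else 0)))"
    by (rule sum_choose_Suc_mult)
  also have "\<dots> = (\<Sum>k\<le>n. int (n choose k) * (if [int k = r] (mod 3) then a ^ k else 0))
      + a * (\<Sum>k\<le>n. int (n choose k) * (if [int k = r - 1] (mod 3) then a ^ k else 0))"
    unfolding shift sum_distrib_left sum.distrib[symmetric]
    by (intro sum.cong) (auto simp: algebra_simps)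
  finally show ?thesis
    by (simp only: Delta3_eq_sum_atMost) (simp add: algebra_simps)
qed

lemma Delta3_cong: "[r = s] (mod 3) \<Longrightarrow> Delta3 a r n = Delta3 a s n"
  by (simp add: Delta3_def cong_def)

lemma Delta3_0_right: "Delta3 a r 0 = (if [0 = r] (mod 3) then 2 else - 1)"
  by (simp add: Delta3_eq_sum_atMost)

theorem theorem4p1:
  fixes a :: int and u :: "nat \<Rightarrow> int"
  assumes "a \<notin> {0, 1, -1}"
    and "u 0 = 0"
    and "u 1 = 1"
    and "\<And>n. n \<ge> 1 \<Longrightarrow> u (n + 1) = (2 - a) * u n - (a\<^sup>2 - a + 1) * u (n - 1)"
  shows "\<forall>n\<ge>1.
      Delta3 a 0 n = (2 - a) * u n - 2 * (a\<^sup>2 - a + 1) * u (n - 1) \<and>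
      (2 - a) * u n - 2 * (a\<^sup>2 - a + 1) * u (n - 1) = 2 * u (n + 1) - (2 - a) * u n \<and>
      Delta3 a 1 n = (2 * a - 1) * u n + (a\<^sup>2 - a + 1) * u (n - 1) \<and>
      (2 * a - 1) * u n + (a\<^sup>2 - a + 1) * u (n - 1) = - u (n + 1) + (a + 1) * u n \<and>
      Delta3 a 2 n = (- a - 1) * u n + (a\<^sup>2 - a + 1) * u (n - 1) \<and>
      (- a - 1) * u n + (a\<^sup>2 - a + 1) * u (n - 1) = - u (n + 1) - (2 * a - 1) * u n"
proof -
  have rec: "u (Suc (Suc n)) = (2 - a) * u (Suc n) - (a\<^sup>2 - a + 1) * u n" for n
    using assms(4)[of "Suc n"] by simp
  \<comment> \<open>These forms avoid \<open>u (n - 1)\<close>, so the induction can start at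
    0.\<close>
  have Delta3: "Delta3 a 0 n = 2 * u (Suc n) - (2 - a) * u n \<and>
      Delta3 a 1 n = - u (Suc n) + (a + 1) * u n \<and>
      Delta3 a 2 n = - u (Suc n) - (2 * a - 1) * u n" for n
  proof (induction n)
    case 0
    show ?case
      using assms(2,3) by (simp add: Delta3_0_right cong_def)
  next
    case (Suc n)
    \<comment> \<open>For \<open>r = 0\<close> the shift leads to residue -1; identifying it with 2
      closes the system of three sequences.\<close>
    have "Delta3 a (- 1) n = Delta3 a 2 n"
      by (rule Delta3_cong) (simp add: cong_def)
    with Suc show ?case
      by (simp add: Delta3_Suc rec) (simp add: algebra_simps power2_eq_square)
  qed
  show ?thesis
  proof (intro allI impI)
    fix n :: nat
    assume "n \<ge> 1"
    \<comment> \<open>Writing \<open>n\<close> as a successor lets \<open>rec\<close> eliminate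
      \<open>u (n + 1)\<close>, which turns the forms just proved into those with
      \<open>u (n - 1)\<close>.\<close>
    then obtain m where n: "n = Suc m"
      by (cases n) auto
    show "Delta3 a 0 n = (2 - a) * u n - 2 * (a\<^sup>2 - a + 1) * u (n - 1) \<and>
      (2 - a) * u n - 2 * (a\<^sup>2 - a + 1) * u (n - 1) = 2 * u (n + 1) - (2 - a) * u n \<and>
      Delta3 a 1 n = (2 * a - 1) * u n + (a\<^sup>2 - a + 1) * u (n - 1) \<and>
      (2 * a - 1) * u n + (a\<^sup>2 - a + 1) * u (n - 1) = - u (n + 1) + (a + 1) * u n \<and>
      Delta3 a 2 n = (- a - 1) * u n + (a\<^sup>2 - a + 1) * u (n - 1) \<and>
      (- a - 1) * u n + (a\<^sup>2 - a + 1) * u (n - 1) = - u (n + 1) - (2 * a - 1) * u n"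
      using Delta3[of n] unfolding n by (simp add: rec) (simp add: algebra_simps)
  qed
qed

end
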